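(* Let $\epsilon\in(0,1)$ and let $C>0$ be a sufficiently large constant. Consider $n\times n$ real matrices $A$ all of whose entries lie in $\{-1,-1+1/n^C,-1+2/n^C,\dots,1-1/n^C,1\}$. Any sketch $s(A)$ of such matrices satisfying the for all guarantee (with approximation factor $1+\epsilon$) must use $\Omega(n^2)$ bits of space.
   Context: A sketch $s(\cdot)$ satisfies the for all guarantee if from $s(A)$ one can compute, for every query vector $x\in\mathbb{R}^n$ simultaneously, a value $v(x)\in[(1-\epsilon)\|Ax\|_2^2,(1+\epsilon)\|Ax\|_2^2]$. *)

theory Defs
  imports Complex_Main "Jordan_Normal_Form.Matrix"
begin

definition l2_norm :: "real vec \<Rightarrow> real" where
  "l2_norm y = sqrt (\<Sum>i<dim_vec y. (y $ i)\<^sup>2)"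

text \<open>The set \<open>{-1, -1 + 1/n^C, \<dots>, 1 - 1/n^C, 1}\<close>. The exponent \<open>C\<close> is real; when \<open>2 n^C\<close>
  is not an integer, the progression stops at its last term not exceeding \<open>1\<close>.\<close>

definition entry_grid :: "real \<Rightarrow> nat \<Rightarrow> real set" where
  "entry_grid C n = {-1 + real k / (real n powr C) | k :: nat. -1 + real k / (real n powr C) \<le> 1}"

definition grid_matrices :: "real \<Rightarrow> nat \<Rightarrow> real mat set" where
  "grid_matrices C n =
     {A \<in> carrier_mat n n. \<forall>i<n. \<forall>j<n. A $$ (i, j) \<in> entry_grid C n}"

text \<open>A sketch maps matrices to bit strings. The estimates \<open>v\<close> see the matrix only through its
  sketch. No computability is required of \<open>s\<close> or \<open>v\<close>.\<close>

definition for_all_guarantee ::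
  "nat \<Rightarrow> real \<Rightarrow> real mat set \<Rightarrow> (real mat \<Rightarrow> bool list) \<Rightarrow> bool" where
  "for_all_guarantee n \<epsilon> M s \<longleftrightarrow>
     (\<exists>v :: bool list \<Rightarrow> real vec \<Rightarrow> real. \<forall>A\<in>M. \<forall>x\<in>carrier_vec n.
        v (s A) x \<in> {(1 - \<epsilon>) * (l2_norm (A *\<^sub>v x))\<^sup>2 .. (1 + \<epsilon>) * (l2_norm (A *\<^sub>v x))\<^sup>2})"

definition uses_at_most_bits :: "real mat set \<Rightarrow> (real mat \<Rightarrow> bool list) \<Rightarrow> nat \<Rightarrow> bool" where
  "uses_at_most_bits M s b \<longleftrightarrow> (\<forall>A\<in>M. length (s A) \<le> b)"

end

theory Submission
  imports Defs
begin

text \<open>For \<open>\<epsilon> < 1\<close> an estimate vanishes exactly when \<open>A x = 0\<close>, so a sketch with the for all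
  guarantee determines the kernel of \<open>A\<close>. It therefore suffices to exhibit \<open>2^(m\<^sup>2)\<close> grid matrices,
  \<open>m = n div 3\<close>, with pairwise distinct kernels. Take \<open>A = -J + \<delta> B\<close> with \<open>J\<close> the all-ones matrix,
  \<open>\<delta> = n^(-C)\<close> and \<open>B\<close> a 0/1 matrix whose first \<open>m\<close> rows are \<open>[I | 0 | S | 0]\<close>, where \<open>S\<close> is an
  arbitrary \<open>m \<times> m\<close> block, and whose other rows vanish. On vectors with coordinate sum \<open>0\<close> the matrix
  \<open>A\<close> acts as \<open>\<delta> B\<close>, and the linear dependencies of the columns of \<open>B\<close> reveal \<open>S\<close>; the zero column
  of \<open>B\<close> is there to adjust the coordinate sum.\<close>

lemma l2_norm_eq_0_iff: "l2_norm y = 0 \<longleftrightarrow> y = 0\<^sub>v (dim_vec y)"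
proof -
  have "l2_norm y = 0 \<longleftrightarrow> (\<forall>i<dim_vec y. y $ i = 0)"
    by (auto simp: l2_norm_def sum_nonneg_eq_0_iff)
  then show ?thesis
    by (auto simp: vec_eq_iff)
qed

text \<open>At a kernel vector of \<open>A\<close> the allowed interval shrinks to the point 0. The
  same estimate must serve \<open>A'\<close>, and its lower bound has the positive factor
  \<open>1 - \<epsilon>\<close>.\<close>

lemma for_all_guarantee_kernel_subset:
  assumes "for_all_guarantee n \<epsilon> M s" "\<epsilon> < 1" "A \<in> M" "A' \<in> M" "s A = s A'"
    and "x \<in> carrier_vec n" "A *\<^sub>v x = 0\<^sub>v (dim_row A)"
  shows "A' *\<^sub>v x = 0\<^sub>v (dim_row A')"
proof -
  obtain v where v: "\<And>A x. A \<in> M \<Longrightarrow> x \<in> carrier_vec n \<Longrightarrow>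
      v (s A) x \<in> {(1 - \<epsilon>) * (l2_norm (A *\<^sub>v x))\<^sup>2 .. (1 + \<epsilon>) * (l2_norm (A *\<^sub>v x))\<^sup>2}"
    using assms(1) unfolding for_all_guarantee_def by blast
  have "l2_norm (A *\<^sub>v x) = 0"
    using assms(7) by (simp add: l2_norm_eq_0_iff)
  then have "v (s A) x = 0"
    using v[OF assms(3,6)] by simp
  then have "(1 - \<epsilon>) * (l2_norm (A' *\<^sub>v x))\<^sup>2 \<le> 0"
    using v[OF assms(4,6)] assms(5) by simp
  then have "(l2_norm (A' *\<^sub>v x))\<^sup>2 \<le> 0"
    using assms(2) by (simp add: mult_le_0_iff)
  then have "l2_norm (A' *\<^sub>v x) = 0"
    by simp
  then show ?thesis
    by (simp add: l2_norm_eq_0_iff)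
qed

text \<open>There are 1 + 2 + ... + 2^b = 2^(b+1) - 1 such strings; the strict bound later avoids
  losing a bit.\<close>

lemma card_less_of_short_bit_strings:
  fixes f :: "'a \<Rightarrow> bool list"
  assumes "inj_on f X" "\<And>x. x \<in> X \<Longrightarrow> length (f x) \<le> b"
  shows "card X < 2 ^ Suc b"
proof -
  let ?L = "{xs :: bool list. set xs \<subseteq> UNIV \<and> length xs \<le> b}"
  have "card X \<le> card ?L"
    using assms by (intro card_inj_on_le[of f] finite_lists_length_le) auto
  also have "\<dots> = (\<Sum>i\<le>b. 2 ^ i)"
    by (subst card_lists_length_le) auto
  also have "\<dots> < 2 ^ Suc b"
    by (induction b) auto
  finally show ?thesis .
qed

text \<open>The guard \<open>m < k\<close> keeps the truncated difference \<open>k - Suc m\<close>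
  from reading columns up to \<open>m\<close> as column 0 of \<open>S\<close>.\<close>

definition code_mat :: "nat \<Rightarrow> nat \<Rightarrow> real \<Rightarrow> (nat \<times> nat) set \<Rightarrow> real mat" where
  "code_mat n m \<delta> S = mat n n (\<lambda>(i, k).
     -1 + \<delta> * of_bool (i < m \<and> (k = i \<or> m < k \<and> (i, k - Suc m) \<in> S)))"

text \<open>Column \<open>m + 1 + j\<close> of \<open>B\<close> minus the unit columns it is the sum of, balanced to coordinate
  sum \<open>0\<close> by the zero column \<open>m\<close>.\<close>

definition column_query :: "nat \<Rightarrow> nat \<Rightarrow> (nat \<times> nat) set \<Rightarrow> nat \<Rightarrow> real vec" where
  "column_query n m S j = vec n (\<lambda>k. of_bool (k = Suc m + j) - of_bool (k < m \<and> (k, j) \<in> S)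
     + of_bool (k = m) * (real (card {i. i < m \<and> (i, j) \<in> S}) - 1))"

lemma code_mat_dim [simp]:
  "dim_row (code_mat n m \<delta> S) = n" "dim_col (code_mat n m \<delta> S) = n"
  by (simp_all add: code_mat_def)

lemma column_query_carrier [simp]: "column_query n m S j \<in> carrier_vec n"
  by (simp add: column_query_def)

lemma sum_of_bool_index:
  fixes a :: "'a :: semiring_1" and l n :: nat
  assumes "l < n"
  shows "(\<Sum>k<n. of_bool (k = l) * a) = a"
proof -
  have "(\<Sum>k<n. of_bool (k = l) * a) = (\<Sum>k<n. if k = l then a else 0)"
    by (rule sum.cong) auto
  then show ?thesis
    using assms by simp
qed

lemma column_query_sum:
  assumes "j < m" "2 * m < n"
  shows "(\<Sum>k<n. column_query n m S j $ k) = 0"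
proof -
  have "{..<n} \<inter> {k. k < m \<and> (k, j) \<in> S} = {k. k < m \<and> (k, j) \<in> S}"
    using assms by auto
  then have "(\<Sum>k<n. of_bool (k < m \<and> (k, j) \<in> S)) = real (card {k. k < m \<and> (k, j) \<in> S})"
    by simp
  moreover have "(\<Sum>k<n. of_bool (k = Suc m + j)) = (1::real)"
    using sum_of_bool_index[of "Suc m + j" n "1::real"] assms by simp
  moreover have "(\<Sum>k<n. of_bool (k = m) * (real (card {i. i < m \<and> (i, j) \<in> S}) - 1))
      = real (card {i. i < m \<and> (i, j) \<in> S}) - 1"
    using assms by (intro sum_of_bool_index) simp
  ultimately show ?thesis
    by (simp add: column_query_def sum.distrib sum_subtractf del: sum_of_bool_eq sum_of_bool_mult_eq)
qed

lemma code_mat_mult_column_query: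
  assumes "j < m" "2 * m < n" "i < n"
  shows "(code_mat n m \<delta> S' *\<^sub>v column_query n m S j) $ i
     = \<delta> * of_bool (i < m) * (of_bool ((i, j) \<in> S') - of_bool ((i, j) \<in> S))"
proof -
  let ?x = "column_query n m S j"
  let ?a = "\<delta> * of_bool (i < m) * of_bool ((i, j) \<in> S')"
  let ?b = "\<delta> * of_bool (i < m) * of_bool ((i, j) \<in> S)"
  \<comment> \<open>The summand \<open>- ?x $ k\<close> comes from -J and sums to 0. On the support
    of the query, row \<open>i\<close> of B can be nonzero only at \<open>k = i\<close> and
    \<open>k = Suc m + j\<close>.\<close>
  have entry: "code_mat n m \<delta> S' $$ (i, k) * ?x $ k
      = of_bool (k = Suc m + j) * ?a - of_bool (k = i) * ?b - ?x $ k" if "k < n" for k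
    using that assms
    by (cases "k = Suc m + j"; cases "k < m"; cases "k = m")
       (auto simp: code_mat_def column_query_def algebra_simps)
  have "(code_mat n m \<delta> S' *\<^sub>v ?x) $ i = (\<Sum>k<n. code_mat n m \<delta> S' $$ (i, k) * ?x $ k)"
    using assms by (simp add: scalar_prod_def column_query_def lessThan_atLeast0)
  also have "\<dots> = (\<Sum>k<n. of_bool (k = Suc m + j) * ?a) - (\<Sum>k<n. of_bool (k = i) * ?b)
      - (\<Sum>k<n. ?x $ k)"
    by (simp add: entry sum_subtractf del: sum_of_bool_eq sum_of_bool_mult_eq)
  also have "\<dots> = ?a - ?b"
    using assms sum_of_bool_index[of "Suc m + j" n ?a] sum_of_bool_index[of i n ?b]
    by (simp add: column_query_sum del: sum_of_bool_eq sum_of_bool_mult_eq)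
  finally show ?thesis
    by (simp add: algebra_simps)
qed

text \<open>The case \<open>S' = S\<close> puts the query in the kernel, so equal kernels force
  equal columns \<open>j\<close> of the two blocks.\<close>

lemma code_mat_mult_column_query_eq_0_iff:
  assumes "j < m" "2 * m < n" "\<delta> \<noteq> 0"
  shows "code_mat n m \<delta> S' *\<^sub>v column_query n m S j = 0\<^sub>v n
     \<longleftrightarrow> (\<forall>i<m. (i, j) \<in> S' \<longleftrightarrow> (i, j) \<in> S)"
proof -
  have "code_mat n m \<delta> S' *\<^sub>v column_query n m S j = 0\<^sub>v n \<longleftrightarrow>
      (\<forall>i<n. (code_mat n m \<delta> S' *\<^sub>v column_query n m S j) $ i = 0)"
    by (simp add: vec_eq_iff del: index_mult_mat_vec)
  also have "\<dots> \<longleftrightarrow> (\<forall>i<n. i < m \<longrightarrow> ((i, j) \<in> S' \<longleftrightarrow> (i, j) \<in> S))"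
    using assms by (auto simp: code_mat_mult_column_query simp del: index_mult_mat_vec)
  also have "\<dots> \<longleftrightarrow> (\<forall>i<m. (i, j) \<in> S' \<longleftrightarrow> (i, j) \<in> S)"
    using assms by auto
  finally show ?thesis .
qed

lemma code_mat_in_grid_matrices:
  assumes "n > 0" "C \<ge> 0"
  shows "code_mat n m (1 / real n powr C) S \<in> grid_matrices C n"
proof -
  have "real n powr C \<ge> 1"
    using assms by (intro ge_one_powr_ge_zero) auto
  then have "1 / real n powr C \<le> 2"
    by (simp add: divide_le_eq)
  \<comment> \<open>These are the grid points with \<open>k = 1\<close> and \<open>k = 0\<close>;
    the bound 2 keeps the former at most 1.\<close>
  then have "-1 + 1 / real n powr C \<in> entry_grid C n" "-1 \<in> entry_grid C n"
    unfolding entry_grid_def by (auto intro: exI[of _ "1::nat"] exI[of _ "0::nat"])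
  then show ?thesis
    by (auto simp: grid_matrices_def code_mat_def of_bool_def)
qed

lemma for_all_guarantee_bits_lower_bound:
  assumes guar: "for_all_guarantee n \<epsilon> (grid_matrices C n) s"
    and bits: "uses_at_most_bits (grid_matrices C n) s b"
    and "\<epsilon> < 1" "C \<ge> 0" "2 * m < n"
  shows "m\<^sup>2 \<le> b"
proof -
  let ?A = "code_mat n m (1 / real n powr C)"
  let ?X = "Pow ({..<m} \<times> {..<m})"
  have grid: "?A S \<in> grid_matrices C n" for S
    using assms by (intro code_mat_in_grid_matrices) auto
  have \<delta>: "1 / real n powr C \<noteq> 0"
    using assms by simp
  have agree: "(i, j) \<in> S' \<longleftrightarrow> (i, j) \<in> S"
    if "s (?A S) = s (?A S')" "i < m" "j < m" for S S' i j
  proof -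
    have "?A S *\<^sub>v column_query n m S j = 0\<^sub>v (dim_row (?A S))"
      using that assms \<delta> by (simp add: code_mat_mult_column_query_eq_0_iff)
    from for_all_guarantee_kernel_subset[OF guar \<open>\<epsilon> < 1\<close> grid grid that(1) _ this]
    show ?thesis
      using that assms \<delta> by (simp add: code_mat_mult_column_query_eq_0_iff)
  qed
  have "inj_on (\<lambda>S. s (?A S)) ?X"
  proof (rule inj_onI)
    fix S S' assume "S \<in> ?X" "S' \<in> ?X" "s (?A S) = s (?A S')"
    with agree[of S S'] show "S = S'"
      by blast
  qed
  then have "card ?X < 2 ^ Suc b"
    by (rule card_less_of_short_bit_strings)
       (use bits grid in \<open>auto simp: uses_at_most_bits_def\<close>)
  then have "(2::nat) ^ m\<^sup>2 < 2 ^ Suc b"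
    by (simp add: card_Pow card_cartesian_product power2_eq_square)
  then show ?thesis
    by (simp only: power_strict_increasing_iff less_Suc_eq_le one_less_numeral_iff semiring_norm)
qed

theorem theorem5:
  shows "\<exists>C0>0. \<forall>C\<ge>C0. \<exists>c>0. \<exists>n0::nat. \<forall>n\<ge>n0. \<forall>\<epsilon>::real. 0 < \<epsilon> \<longrightarrow> \<epsilon> < 1 \<longrightarrow>
    (\<forall>(s :: real mat \<Rightarrow> bool list) (b :: nat).
       for_all_guarantee n \<epsilon> (grid_matrices C n) s \<longrightarrow>
       uses_at_most_bits (grid_matrices C n) s b \<longrightarrow>
       c * (real n)\<^sup>2 \<le> real b)"
proof -
  have "1 / 25 * (real n)\<^sup>2 \<le> real b"
    if "C \<ge> 1" "n \<ge> 3" "\<epsilon> < 1" "for_all_guarantee n \<epsilon> (grid_matrices C n) s"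
      "uses_at_most_bits (grid_matrices C n) s b" for C \<epsilon> :: real and n b :: nat and s
  proof -
    have "(n div 3)\<^sup>2 \<le> b"
      using that by (intro for_all_guarantee_bits_lower_bound[OF that(4,5)]) auto
    \<comment> \<open>The worst case is \<open>n = 5\<close>, where \<open>n div 3 = 1\<close>;
      squaring gives the constant 1/25.\<close>
    have "n \<le> 5 * (n div 3)"
      using \<open>n \<ge> 3\<close> by presburger
    then have "n\<^sup>2 \<le> (5 * (n div 3))\<^sup>2"
      by (rule power_mono) simp
    also have "\<dots> \<le> 25 * b"
      using \<open>(n div 3)\<^sup>2 \<le> b\<close> by (simp add: power_mult_distrib)
    finally have "real (n\<^sup>2) \<le> real (25 * b)"
      by (simp only: of_nat_le_iff)
    then show ?thesis
      by simp
  qed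
  then show ?thesis
    by (intro exI[of _ "1::real"] conjI allI impI exI[of _ "1/25::real"] exI[of _ "3::nat"]) auto
qed

end
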